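(* Let $M,K,L$ be real skew-symmetric $d\times d$ matrices and let $S(z,x,y)$ be a real-valued function, smooth in $z\in\mathbb{R}^d$, with gradient $\nabla_z S$ in $z$. Let $N_1,N_2$ be even positive integers, $L_1,L_2>0$, $\Delta x=L_1/N_1$, $\Delta y=L_2/N_2$, $x_j=x_0+j\Delta x$ for $0\le j\le N_1-1$, $y_l=y_0+l\Delta y$ for $0\le l\le N_2-1$, and $\Delta t>0$. Let $D_x$ ($N_1\times N_1$) and $D_y$ ($N_2\times N_2$) be the Fourier pseudospectral differentiation matrices in the $x$ and $y$ directions, and let $A_{\tau,\sigma}$, $b_i$, $\langle\cdot\rangle_i$ ($i=1,\ldots,s$) be the objects attached to the continuous Runge--Kutta method with nodes $c_1,\ldots,c_s$ (all defined in the context). Suppose that the $\mathbb{R}^d$-valued polynomials $\tau\mapsto z_{jl}^\tau$ and $\tau\mapsto\delta_t z_{jl}^\tau$ satisfy the fully discrete scheme $$ \begin{aligned} &z_{jl}^{\tau}=z_{jl}^{0}+\Delta t\int_{0}^{1}A_{\tau,\sigma}\,\delta_{t}z_{jl}^{\sigma}\,d\sigma,\qquad z_{jl}^{1}=z_{jl}^{0}+\Delta t\int_{0}^{1}\delta_{t}z_{jl}^{\sigma}\,d\sigma,\\ &\delta_{x}z_{jl}^{\tau}=\sum_{k=0}^{N_1-1}(D_{x})_{jk}z_{kl}^{\tau},\qquad \delta_{y}z_{jl}^{\tau}=\sum_{m=0}^{N_2-1}(D_{y})_{lm}z_{jm}^{\tau},\\ &M\delta_{t}z_{jl}^{\tau}+K\delta_{x}z_{jl}^{\tau}+L\delta_{y}z_{jl}^{\tau}=\nabla_{z}S(z_{jl}^{\tau},x_{j},y_{l}),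 \end{aligned} $$ for all $\tau\in[0,1]$, $0\le j\le N_1-1$, $0\le l\le N_2-1$. Then the following $N_1N_2$ discrete local energy conservation laws hold exactly: $$ \frac{E_{jl}^{1}-E_{jl}^{0}}{\Delta t}+\sum_{k=0}^{N_1-1}(D_{x})_{jk}\bar{F}_{jk,l}+\sum_{m=0}^{N_2-1}(D_{y})_{lm}\bar{G}_{j,lm}=0,\qquad 0\le j\le N_1-1,\ 0\le l\le N_2-1, $$ where $$ E_{jl}^{\alpha}=S(z_{jl}^{\alpha},x_{j},y_{l})-\tfrac12 (z_{jl}^{\alpha})^{\top}K\,\delta_{x}z_{jl}^{\alpha}-\tfrac12 (z_{jl}^{\alpha})^{\top}L\,\delta_{y}z_{jl}^{\alpha}\quad(\alpha=0,1), $$ $$ \bar{F}_{jk,l}=\frac12\sum_{i=1}^{s}b_{i}\Big(\langle z_{jl}\rangle_{i}^{\top}K\langle\delta_{t}z_{kl}\rangle_{i}+\langle z_{kl}\rangle_{i}^{\top}K\langle\delta_{t}z_{jl}\rangle_{i}\Big), $$ $$ \bar{G}_{j,lm}=\frac12\sum_{i=1}^{s}b_{i}\Big(\langle z_{jl}\rangle_{i}^{\top}L\langle\delta_{t}z_{jm}\rangle_{i}+\langle z_{jm}\rangle_{i}^{\top}L\langle\delta_{t}z_{jl}\rangle_{i}\Big). $$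
   Context: The scheme discretizes the PDE $Mz_t+Kz_x+Lz_y=\nabla_z S(z,x,y)$ with periodic boundary conditions $z(x_0,y,t)=z(x_0+L_1,y,t)$, $z(x,y_0,t)=z(x,y_0+L_2,t)$; here $z_{jl}^\tau\approx z(x_j,y_l,t_0+\tau\Delta t)$ and $\delta_t z_{jl}^\tau\approx\partial_t z(x_j,y_l,t_0+\tau\Delta t)$. The symbol $\delta_t z_{jl}^\tau$ denotes an independent unknown function of $\tau$ tied to $z_{jl}^\tau$ only through the scheme. Continuous Runge--Kutta (CRK) method: $c_1,\ldots,c_s$ are distinct real nodes, $l_1,\ldots,l_s$ (here the subscripted letters denote polynomials, not the grid index $l$) are the Lagrange interpolating polynomials based on these nodes, $b_i=\int_0^1 l_i(\tau)\,d\tau$ (assumed nonzero), and $$A_{\tau,\sigma}=\sum_{i=1}^{s}\frac{1}{b_i}\left(\int_0^\tau l_i(\alpha)\,d\alpha\right) l_i(\sigma).$$ For a (scalar- or vector-valued) function $f$ of $\tau\in[0,1]$, $\langle f\rangle_i=\frac{1}{b_i}\int_0^1 l_i(\tau)f(\tau)\,d\tau$; e.g. $\langle z_{jl}\rangle_i=\frac1{b_i}\int_0^1 l_i(\tau)z_{jl}^\tau\,d\tau$ and $\langle \delta_t z_{jl}\rangle_i=\frac1{b_i}\int_0^1 l_i(\tau)\,\delta_t z_{jl}^\tau\,d\tau$. Pseudospectral differentiation matrices: $(D_x)_{jk}=\frac{\pi}{L_1}(-1)^{j+k}\cot\!\big(\pi\frac{x_j-x_k}{L_1}\big)$ for $j\ne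 k$ and $(D_x)_{jj}=0$; $(D_y)_{lm}=\frac{\pi}{L_2}(-1)^{l+m}\cot\!\big(\pi\frac{y_l-y_m}{L_2}\big)$ for $l\ne m$ and $(D_y)_{ll}=0$. Both are skew-symmetric. *)

theory Defs
  imports "HOL-Analysis.Analysis"
begin

primrec Ck :: "nat \<Rightarrow> ('a::euclidean_space \<Rightarrow> real) \<Rightarrow> bool" where
  "Ck 0 f \<longleftrightarrow> continuous_on UNIV f"
| "Ck (Suc k) f \<longleftrightarrow> (\<forall>z. f differentiable (at z)) \<and>
     (\<forall>b\<in>Basis. Ck k (\<lambda>z. frechet_derivative f (at z) b))"

definition smooth :: "('a::euclidean_space \<Rightarrow> real) \<Rightarrow> bool" where
  "smooth f \<longleftrightarrow> (\<forall>k. Ck k f)"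

definition gradient :: "('a::real_inner \<Rightarrow> real) \<Rightarrow> 'a \<Rightarrow> 'a" where
  "gradient f z = (THE D. GDERIV f z :> D)"

definition skew_symmetric :: "real^'d^'d \<Rightarrow> bool" where
  "skew_symmetric A \<longleftrightarrow> transpose A = - A"


text \<open>The nodes of the continuous Runge--Kutta method are \<open>c 1, \<dots>, c s\<close>;
  values of \<open>c\<close> at other indices play no role.\<close>

definition lagrange_poly :: "nat \<Rightarrow> (nat \<Rightarrow> real) \<Rightarrow> nat \<Rightarrow> real \<Rightarrow> real" where
  "lagrange_poly s c i \<tau> = (\<Prod>m\<in>{1..s} - {i}. (\<tau> - c m) / (c i - c m))"

definition crk_weight :: "nat \<Rightarrow> (nat \<Rightarrow> real) \<Rightarrow> nat \<Rightarrow> real" where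
  "crk_weight s c i = integral {0..1} (lagrange_poly s c i)"

text \<open>The set integral over \<open>{0..\<tau>}\<close> agrees with the oriented one only for
  \<open>\<tau> \<ge> 0\<close>; the kernel \<open>A\<^sub>\<tau>\<^sub>,\<^sub>\<sigma>\<close> is used for \<open>\<tau>\<close> in \<open>{0..1}\<close> only.\<close>

definition crk_kernel :: "nat \<Rightarrow> (nat \<Rightarrow> real) \<Rightarrow> real \<Rightarrow> real \<Rightarrow> real" where
  "crk_kernel s c \<tau> \<sigma> =
     (\<Sum>i=1..s. 1 / crk_weight s c i * integral {0..\<tau>} (lagrange_poly s c i)
                 * lagrange_poly s c i \<sigma>)"

definition crk_mean ::
  "nat \<Rightarrow> (nat \<Rightarrow> real) \<Rightarrow> nat \<Rightarrow> (real \<Rightarrow> 'a::real_normed_vector) \<Rightarrow> 'a" where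
  "crk_mean s c i f =
     (1 / crk_weight s c i) *\<^sub>R integral {0..1} (\<lambda>\<tau>. lagrange_poly s c i \<tau> *\<^sub>R f \<tau>)"


text \<open>\<open>\<Lambda>\<close> is the spatial period and \<open>x\<close> the grid; indices start at 0.\<close>

definition fourier_diff :: "real \<Rightarrow> (nat \<Rightarrow> real) \<Rightarrow> nat \<Rightarrow> nat \<Rightarrow> real" where
  "fourier_diff \<Lambda> x j k =
     (if j = k then 0 else pi / \<Lambda> * (-1) ^ (j + k) * cot (pi * (x j - x k) / \<Lambda>))"


text \<open>In \<open>local_energy\<close> the vectors \<open>w\<^sub>x\<close>, \<open>w\<^sub>y\<close> are the values of \<open>\<delta>\<^sub>x z\<close>, \<open>\<delta>\<^sub>y z\<close>.
  In \<open>crk_flux\<close> the matrix is \<open>K\<close> for the \<open>x\<close>-flux and \<open>L\<close> for the \<open>y\<close>-flux; the functions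
  \<open>u\<close>, \<open>v\<close> are \<open>z\<close> at two grid points, and \<open>u'\<close>, \<open>v'\<close> are \<open>\<delta>\<^sub>t z\<close> there
  (not derivatives of \<open>u\<close>, \<open>v\<close>).\<close>

definition local_energy ::
  "(real^'d \<Rightarrow> real \<Rightarrow> real \<Rightarrow> real) \<Rightarrow> real^'d^'d \<Rightarrow> real^'d^'d \<Rightarrow> real \<Rightarrow> real \<Rightarrow>
   real^'d \<Rightarrow> real^'d \<Rightarrow> real^'d \<Rightarrow> real" where
  "local_energy S K L x y w w\<^sub>x w\<^sub>y =
     S w x y - 1/2 * (w \<bullet> (K *v w\<^sub>x)) - 1/2 * (w \<bullet> (L *v w\<^sub>y))"

definition crk_flux ::
  "nat \<Rightarrow> (nat \<Rightarrow> real) \<Rightarrow> real^'d^'d \<Rightarrow> (real \<Rightarrow> real^'d) \<Rightarrow> (real \<Rightarrow> real^'d) \<Rightarrow>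
   (real \<Rightarrow> real^'d) \<Rightarrow> (real \<Rightarrow> real^'d) \<Rightarrow> real" where
  "crk_flux s c K u u' v v' =
     1/2 * (\<Sum>i=1..s. crk_weight s c i *
              (crk_mean s c i u \<bullet> (K *v crk_mean s c i v') +
               crk_mean s c i v \<bullet> (K *v crk_mean s c i u')))"

end

theory Submission
  imports Defs
begin

text \<open>Differentiating the stage equation gives \<open>z' = \<Delta>t \<Sum>\<^sub>i l\<^sub>i \<langle>\<delta>\<^sub>t z\<rangle>\<^sub>i\<close>, so integrals of \<open>z'\<close> against any
  function \<open>f\<close> become the weighted sums \<open>\<Delta>t \<Sum>\<^sub>i b\<^sub>i \<langle>\<delta>\<^sub>t z\<rangle>\<^sub>i \<bullet> \<langle>f\<rangle>\<^sub>i\<close>. Integrate the inner product of \<open>z'\<close> with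
  the scheme over \<open>{0..1}\<close>: the right-hand side is the increment of \<open>S\<close> along \<open>z\<close>, the \<open>M\<close>-term vanishes
  by skew-symmetry, and each \<open>\<integral> u' \<bullet> A v\<close> with \<open>A\<close> skew splits into half the increment of \<open>u \<bullet> A v\<close>
  and a flux.\<close>

text \<open>Since \<open>gradient\<close> is a definite description, it can be used only once
  existence and uniqueness are known. Existence comes from first-order smoothness, uniqueness from
  that of the Frechet derivative.\<close>

lemma smooth_has_gradient:
  fixes f :: "'a::euclidean_space \<Rightarrow> real"
  assumes "smooth f"
  shows "GDERIV f w :> gradient f w"
proof -
  have "Ck (Suc 0) f"
    using assms unfolding smooth_def by blast
  then obtain f' where f': "(f has_derivative f') (at w)"
    by (auto simp: differentiable_def)
  then have "linear f'"
    by (rule has_derivative_linear)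
  \<comment> \<open>Riesz representation of the functional \<open>f'\<close>: its adjoint applied to
    the real number 1 is the representing vector.\<close>
  then have "f' = (\<lambda>h. adjoint f' 1 \<bullet> h)"
    using adjoint_works[of f'] by (fastforce simp: inner_commute)
  with f' have D: "GDERIV f w :> adjoint f' 1"
    unfolding gderiv_def by (simp add: inner_commute)
  show ?thesis
    unfolding gradient_def
  proof (rule theI[where P = "\<lambda>D. GDERIV f w :> D", OF D])
    fix E assume "GDERIV f w :> E"
    then show "E = adjoint f' 1"
      using D unfolding gderiv_def
      by (metis (no_types, lifting) has_derivative_unique inner_commute vector_eq_ldot)
  qed
qed

lemma skew_symmetric_inner:
  assumes "skew_symmetric A"
  shows "v \<bullet> (A *v w) = - (w \<bullet> (A *v v))"
proof -
  have "v \<bullet> (A *v w) = (transpose A *v v) \<bullet> w"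
    by (simp add: dot_lmul_matrix vector_transpose_matrix)
  also have "transpose A = - A"
    using assms by (simp add: skew_symmetric_def)
  also have "(- A *v v) \<bullet> w = - (w \<bullet> (A *v v))"
    using matrix_vector_mult_diff_rdistrib[of 0 A v] by (simp add: inner_commute)
  finally show ?thesis .
qed

lemma bounded_linear_inner_matrix:
  fixes A :: "real^'n^'m"
  shows "bounded_linear (\<lambda>v. p \<bullet> (A *v v))"
  by (intro bounded_linear_inner_right_comp matrix_vector_mul_bounded_linear)

lemma continuous_on_lagrange_poly [continuous_intros]:
  "continuous_on T (lagrange_poly s c i)"
  unfolding lagrange_poly_def divide_inverse by (intro continuous_intros)

text \<open>The kernel is a finite sum of products of a function of \<tau> and a function of
  \<sigma>, so only the factors \<open>lagrange_poly s c i \<sigma>\<close> are integrated, and the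
  reciprocal weights complete the means.\<close>

lemma integral_crk_kernel:
  fixes f :: "real \<Rightarrow> 'a::euclidean_space"
  assumes "continuous_on {0..1} f"
  shows "integral {0..1} (\<lambda>\<sigma>. crk_kernel s c \<tau> \<sigma> *\<^sub>R f \<sigma>) =
    (\<Sum>i=1..s. integral {0..\<tau>} (lagrange_poly s c i) *\<^sub>R crk_mean s c i f)"
proof -
  have int: "(\<lambda>\<sigma>. lagrange_poly s c i \<sigma> *\<^sub>R f \<sigma>) integrable_on {0..1}" for i
    by (intro integrable_continuous_real continuous_intros assms)
  have "integral {0..1} (\<lambda>\<sigma>. crk_kernel s c \<tau> \<sigma> *\<^sub>R f \<sigma>) =
      integral {0..1} (\<lambda>\<sigma>. \<Sum>i=1..s. (integral {0..\<tau>} (lagrange_poly s c i) / crk_weight s c i) *\<^sub>R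
        (lagrange_poly s c i \<sigma> *\<^sub>R f \<sigma>))"
    by (simp add: crk_kernel_def scaleR_sum_left)
  also have "\<dots> = (\<Sum>i=1..s. (integral {0..\<tau>} (lagrange_poly s c i) / crk_weight s c i) *\<^sub>R
        integral {0..1} (\<lambda>\<sigma>. lagrange_poly s c i \<sigma> *\<^sub>R f \<sigma>))"
    by (subst integral_sum) (auto intro!: integrable_cmul int simp del: scaleR_scaleR)
  finally show ?thesis
    by (simp add: crk_mean_def)
qed

text \<open>For distinct nodes this is the Lagrange interpolant with value
  \<open>crk_mean s c i f\<close> at \<open>c i\<close>. With \<open>f\<close> the unknown
  \<open>\<delta>\<^sub>t\<close> at a grid point it stands for the true derivative of
  \<open>z\<close> divided by the time step, which in general differs from \<open>f\<close>.\<close>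

definition crk_slope ::
  "nat \<Rightarrow> (nat \<Rightarrow> real) \<Rightarrow> (real \<Rightarrow> 'a::real_normed_vector) \<Rightarrow> real \<Rightarrow> 'a" where
  "crk_slope s c f \<tau> = (\<Sum>i=1..s. lagrange_poly s c i \<tau> *\<^sub>R crk_mean s c i f)"

text \<open>Once the kernel is separated, \<tau> enters only through the integrals of the Lagrange
  polynomials from 0 to \<tau>, and the fundamental theorem applies. Derivatives are one-sided at
  the endpoints because the stage equation is assumed on \<open>{0..1}\<close> only.\<close>

lemma crk_stage_has_vector_derivative:
  fixes f :: "real \<Rightarrow> 'a::euclidean_space"
  assumes "continuous_on {0..1} f"
    and "\<And>\<tau>. \<tau> \<in> {0..1} \<Longrightarrow>
      u \<tau> = u 0 + h *\<^sub>R integral {0..1} (\<lambda>\<sigma>. crk_kernel s c \<tau> \<sigma> *\<^sub>R f \<sigma>)"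
    and "\<tau> \<in> {0..1}"
  shows "(u has_vector_derivative h *\<^sub>R crk_slope s c f \<tau>) (at \<tau> within {0..1})"
proof -
  have I: "((\<lambda>t. integral {0..t} (lagrange_poly s c i)) has_real_derivative lagrange_poly s c i \<tau>)
      (at \<tau> within {0..1})" for i
    unfolding has_real_derivative_iff_has_vector_derivative
    using assms(3) by (intro integral_has_vector_derivative continuous_intros)
  have "((\<lambda>t. u 0 + h *\<^sub>R (\<Sum>i=1..s. integral {0..t} (lagrange_poly s c i) *\<^sub>R crk_mean s c i f))
      has_vector_derivative h *\<^sub>R crk_slope s c f \<tau>) (at \<tau> within {0..1})"
    unfolding crk_slope_def by (auto intro!: derivative_eq_intros I simp: I)
  then show ?thesis
    by (rule has_vector_derivative_transform[OF assms(3), rotated])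
      (use assms(2) in \<open>simp only: integral_crk_kernel[OF assms(1)]\<close>)
qed

text \<open>A nonzero weight cancels the reciprocal in \<open>crk_mean\<close>, leaving the moment
  of \<open>f\<close> against a Lagrange polynomial. The weighted sum is therefore the exact
  integral, not a quadrature approximation.\<close>

lemma has_integral_crk_slope_inner:
  fixes A :: "real^'n^'m"
  assumes weights: "\<And>i. i \<in> {1..s} \<Longrightarrow> crk_weight s c i \<noteq> 0"
    and "continuous_on {0..1} f"
  shows "((\<lambda>\<tau>. crk_slope s c g \<tau> \<bullet> (A *v f \<tau>)) has_integral
    (\<Sum>i=1..s. crk_weight s c i * (crk_mean s c i g \<bullet> (A *v crk_mean s c i f)))) {0..1}"
proof -
  have "((\<lambda>\<tau>. \<Sum>i=1..s. crk_mean s c i g \<bullet> (A *v (lagrange_poly s c i \<tau> *\<^sub>R f \<tau>))) has_integral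
    (\<Sum>i=1..s. crk_mean s c i g \<bullet> (A *v (crk_weight s c i *\<^sub>R crk_mean s c i f)))) {0..1}"
  proof (intro has_integral_sum finite_atLeastAtMost)
    fix i assume "i \<in> {1..s}"
    then have "crk_weight s c i *\<^sub>R crk_mean s c i f =
        integral {0..1} (\<lambda>\<tau>. lagrange_poly s c i \<tau> *\<^sub>R f \<tau>)"
      using weights by (simp add: crk_mean_def)
    then have "((\<lambda>\<tau>. lagrange_poly s c i \<tau> *\<^sub>R f \<tau>) has_integral
        crk_weight s c i *\<^sub>R crk_mean s c i f) {0..1}"
      by (simp add: integrable_integral integrable_continuous_real continuous_intros assms(2))
    from has_integral_linear[OF this bounded_linear_inner_matrix]
    show "((\<lambda>\<tau>. crk_mean s c i g \<bullet> (A *v (lagrange_poly s c i \<tau> *\<^sub>R f \<tau>))) has_integral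
        crk_mean s c i g \<bullet> (A *v (crk_weight s c i *\<^sub>R crk_mean s c i f))) {0..1}"
      by (simp add: o_def)
  qed
  then show ?thesis
    by (simp add: crk_slope_def inner_sum_left matrix_vector_mult_scaleR)
qed

text \<open>Adding half of the product rule \<open>(u \<bullet> A v)' = u' \<bullet> A v - v' \<bullet> A u\<close> to the symmetric part
  \<open>(u' \<bullet> A v + v' \<bullet> A u) / 2\<close>, which integrates to minus the flux, recovers \<open>u' \<bullet> A v\<close>.\<close>

lemma has_integral_crk_slope_skew:
  fixes A :: "real^'d^'d"
  assumes weights: "\<And>i. i \<in> {1..s} \<Longrightarrow> crk_weight s c i \<noteq> 0"
    and skew: "skew_symmetric A"
    and u: "\<And>\<tau>. \<tau> \<in> {0..1} \<Longrightarrow>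
      (u has_vector_derivative h *\<^sub>R crk_slope s c u' \<tau>) (at \<tau> within {0..1})"
    and v: "\<And>\<tau>. \<tau> \<in> {0..1} \<Longrightarrow>
      (v has_vector_derivative h *\<^sub>R crk_slope s c v' \<tau>) (at \<tau> within {0..1})"
  shows "((\<lambda>\<tau>. h * (crk_slope s c u' \<tau> \<bullet> (A *v v \<tau>))) has_integral
    (u 1 \<bullet> (A *v v 1) - u 0 \<bullet> (A *v v 0)) / 2 - h * crk_flux s c A u u' v v') {0..1}"
proof -
  have cont: "continuous_on {0..1} u" "continuous_on {0..1} v"
    using u v has_vector_derivative_continuous
    unfolding continuous_on_eq_continuous_within by blast+
  \<comment> \<open>\<open>?Q f g\<close> is the integral of \<open>crk_slope s c g\<close> paired
    with \<open>A *v f\<close>: the state comes first, the function behind the slope second.\<close>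
  let ?Q = "\<lambda>f g. \<Sum>i=1..s. crk_weight s c i * (crk_mean s c i g \<bullet> (A *v crk_mean s c i f))"
  note Q = has_integral_crk_slope_inner[OF weights, where A = A]
  have "((\<lambda>\<tau>. h * (crk_slope s c u' \<tau> \<bullet> (A *v v \<tau>)) - h * (crk_slope s c v' \<tau> \<bullet> (A *v u \<tau>)))
      has_integral u 1 \<bullet> (A *v v 1) - u 0 \<bullet> (A *v v 0)) {0..1}"
  proof (rule fundamental_theorem_of_calculus)
    fix \<tau> :: real assume \<tau>: "\<tau> \<in> {0..1}"
    have "((\<lambda>t. A *v v t) has_vector_derivative A *v (h *\<^sub>R crk_slope s c v' \<tau>))
        (at \<tau> within {0..1})"
      by (rule bounded_linear.has_vector_derivative[OF matrix_vector_mul_bounded_linear v[OF \<tau>]])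
    from bounded_bilinear.has_vector_derivative[OF bounded_bilinear_inner u[OF \<tau>] this]
    show "((\<lambda>t. u t \<bullet> (A *v v t)) has_vector_derivative
        h * (crk_slope s c u' \<tau> \<bullet> (A *v v \<tau>)) - h * (crk_slope s c v' \<tau> \<bullet> (A *v u \<tau>)))
        (at \<tau> within {0..1})"
      by (simp add: matrix_vector_mult_scaleR skew_symmetric_inner[OF skew, of "u \<tau>"] algebra_simps)
  qed simp
  \<comment> \<open>The same integral is evaluated again, now through the means; comparing the two
    values gives a discrete product rule.\<close>
  moreover have "((\<lambda>\<tau>. h * (crk_slope s c u' \<tau> \<bullet> (A *v v \<tau>)) - h * (crk_slope s c v' \<tau> \<bullet> (A *v u \<tau>)))
      has_integral h * ?Q v u' - h * ?Q u v') {0..1}"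
    by (intro has_integral_diff has_integral_mult_right Q cont) auto
  ultimately have diff: "u 1 \<bullet> (A *v v 1) - u 0 \<bullet> (A *v v 0) = h * ?Q v u' - h * ?Q u v'"
    by (rule has_integral_unique)
  \<comment> \<open>In \<open>crk_flux\<close> the states stand to the left of \<open>A\<close>;
    moving the slopes there by skew-symmetry produces the minus sign.\<close>
  have flux: "crk_flux s c A u u' v v' = - (?Q u v' + ?Q v u') / 2"
    by (simp add: crk_flux_def skew_symmetric_inner[OF skew, of "crk_mean s c _ u"]
        skew_symmetric_inner[OF skew, of "crk_mean s c _ v"] sum.distrib sum_negf
        sum_subtractf distrib_left right_diff_distrib)
  have "h * ?Q v u' =
      (u 1 \<bullet> (A *v v 1) - u 0 \<bullet> (A *v v 0)) / 2 - h * crk_flux s c A u u' v v'"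
    unfolding diff flux by (simp add: field_simps)
  then show ?thesis
    using has_integral_mult_right[OF Q[OF _ cont(2)], of h u'] by simp
qed

text \<open>Chain rule and fundamental theorem. The increment is exact because \<open>u'\<close> is
  the true derivative of \<open>u\<close>, which is why the scheme is tested with the slope and not
  with \<open>\<delta>\<^sub>t\<close>.\<close>

lemma has_integral_gradient_along:
  fixes f :: "'a::euclidean_space \<Rightarrow> real"
  assumes "smooth f"
    and "\<And>\<tau>. \<tau> \<in> {0..1} \<Longrightarrow> (u has_vector_derivative u' \<tau>) (at \<tau> within {0..1})"
  shows "((\<lambda>\<tau>. u' \<tau> \<bullet> gradient f (u \<tau>)) has_integral f (u 1) - f (u 0)) {0..1}"
proof (rule fundamental_theorem_of_calculus)
  fix \<tau> :: real assume "\<tau> \<in> {0..1}"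
  from assms(2)[OF this] have "(u has_derivative (\<lambda>t. t *\<^sub>R u' \<tau>)) (at \<tau> within {0..1})"
    by (simp add: has_vector_derivative_def)
  moreover have "(f has_derivative (\<lambda>h. h \<bullet> gradient f (u \<tau>))) (at (u \<tau>))"
    using smooth_has_gradient[OF assms(1)] by (simp add: gderiv_def)
  ultimately have "((\<lambda>t. f (u t)) has_derivative (\<lambda>t. (t *\<^sub>R u' \<tau>) \<bullet> gradient f (u \<tau>)))
      (at \<tau> within {0..1})"
    by (rule has_derivative_compose)
  then show "((\<lambda>t. f (u t)) has_vector_derivative u' \<tau> \<bullet> gradient f (u \<tau>)) (at \<tau> within {0..1})"
    by (simp add: has_vector_derivative_def)
qed simp

text \<open>The coefficients \<open>D k\<close>, a row of a differentiation matrix, do not depend on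
  \<tau>. By linearity the boundary terms recombine into \<open>w\<close>, while the fluxes keep
  their coefficients. One form serves both spatial directions.\<close>

lemma has_integral_crk_slope_skew_sum:
  fixes A :: "real^'d^'d" and D :: "'k \<Rightarrow> real"
  assumes weights: "\<And>i. i \<in> {1..s} \<Longrightarrow> crk_weight s c i \<noteq> 0"
    and skew: "skew_symmetric A"
    and u: "\<And>\<tau>. \<tau> \<in> {0..1} \<Longrightarrow>
      (u has_vector_derivative h *\<^sub>R crk_slope s c u' \<tau>) (at \<tau> within {0..1})"
    and v: "\<And>k \<tau>. k \<in> T \<Longrightarrow> \<tau> \<in> {0..1} \<Longrightarrow>
      (v k has_vector_derivative h *\<^sub>R crk_slope s c (v' k) \<tau>) (at \<tau> within {0..1})"
    and w: "\<And>\<tau>. \<tau> \<in> {0..1} \<Longrightarrow> w \<tau> = (\<Sum>k\<in>T. D k *\<^sub>R v k \<tau>)"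
    and "finite T"
  shows "((\<lambda>\<tau>. h * (crk_slope s c u' \<tau> \<bullet> (A *v w \<tau>))) has_integral
    (u 1 \<bullet> (A *v w 1) - u 0 \<bullet> (A *v w 0)) / 2
      - h * (\<Sum>k\<in>T. D k * crk_flux s c A u u' (v k) (v' k))) {0..1}"
proof -
  have A_w: "p \<bullet> (A *v w \<tau>) = (\<Sum>k\<in>T. D k * (p \<bullet> (A *v v k \<tau>)))" if "\<tau> \<in> {0..1}" for p \<tau>
    using that by (simp add: w linear_sum[OF matrix_vector_mul_linear] inner_sum_right
        matrix_vector_mult_scaleR)
  have "((\<lambda>\<tau>. \<Sum>k\<in>T. D k * (h * (crk_slope s c u' \<tau> \<bullet> (A *v v k \<tau>)))) has_integral
    (\<Sum>k\<in>T. D k * ((u 1 \<bullet> (A *v v k 1) - u 0 \<bullet> (A *v v k 0)) / 2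
      - h * crk_flux s c A u u' (v k) (v' k)))) {0..1}"
    by (intro has_integral_sum has_integral_mult_right has_integral_crk_slope_skew
        \<open>finite T\<close> skew weights u v)
  moreover have "(\<Sum>k\<in>T. D k * ((u 1 \<bullet> (A *v v k 1) - u 0 \<bullet> (A *v v k 0)) / 2
      - h * crk_flux s c A u u' (v k) (v' k))) =
    (u 1 \<bullet> (A *v w 1) - u 0 \<bullet> (A *v w 0)) / 2
      - h * (\<Sum>k\<in>T. D k * crk_flux s c A u u' (v k) (v' k))"
    by (simp add: A_w sum_subtractf sum.distrib sum_divide_distrib sum_distrib_left algebra_simps
        diff_divide_distrib)
  ultimately show ?thesis
    by (rule_tac has_integral_eq[rotated]) (auto simp: A_w sum_distrib_left ac_simps)
qed

theorem theorem3p2: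
  fixes M K L :: "real^'d^'d"
    and S :: "real^'d \<Rightarrow> real \<Rightarrow> real \<Rightarrow> real"
    and N\<^sub>1 N\<^sub>2 s :: nat
    and L\<^sub>1 L\<^sub>2 x\<^sub>0 y\<^sub>0 \<Delta>x \<Delta>y \<Delta>t :: real
    and x y c :: "nat \<Rightarrow> real"
    and z \<delta>\<^sub>t \<delta>\<^sub>x \<delta>\<^sub>y :: "nat \<Rightarrow> nat \<Rightarrow> real \<Rightarrow> real^'d"
  assumes skew: "skew_symmetric M" "skew_symmetric K" "skew_symmetric L"
    and S_smooth: "\<And>\<xi> \<eta>. smooth (\<lambda>w. S w \<xi> \<eta>)"
    and N: "0 < N\<^sub>1" "even N\<^sub>1" "0 < N\<^sub>2" "even N\<^sub>2"
    and periods: "0 < L\<^sub>1" "0 < L\<^sub>2"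
    and steps: "\<Delta>x = L\<^sub>1 / real N\<^sub>1" "\<Delta>y = L\<^sub>2 / real N\<^sub>2" "0 < \<Delta>t"
    and x_grid: "\<And>j. j < N\<^sub>1 \<Longrightarrow> x j = x\<^sub>0 + real j * \<Delta>x"
    and y_grid: "\<And>l. l < N\<^sub>2 \<Longrightarrow> y l = y\<^sub>0 + real l * \<Delta>y"
    and stages: "1 \<le> s" "inj_on c {1..s}"
    and weights: "\<And>i. i \<in> {1..s} \<Longrightarrow> crk_weight s c i \<noteq> 0"
    and z_poly: "\<And>j l. j < N\<^sub>1 \<Longrightarrow> l < N\<^sub>2 \<Longrightarrow> polynomial_function (z j l)"
    and \<delta>\<^sub>t_poly: "\<And>j l. j < N\<^sub>1 \<Longrightarrow> l < N\<^sub>2 \<Longrightarrow> polynomial_function (\<delta>\<^sub>t j l)"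
    and crk_stage: "\<And>j l \<tau>. j < N\<^sub>1 \<Longrightarrow> l < N\<^sub>2 \<Longrightarrow> \<tau> \<in> {0..1} \<Longrightarrow>
      z j l \<tau> = z j l 0 + \<Delta>t *\<^sub>R integral {0..1} (\<lambda>\<sigma>. crk_kernel s c \<tau> \<sigma> *\<^sub>R \<delta>\<^sub>t j l \<sigma>)"
    and crk_step: "\<And>j l. j < N\<^sub>1 \<Longrightarrow> l < N\<^sub>2 \<Longrightarrow>
      z j l 1 = z j l 0 + \<Delta>t *\<^sub>R integral {0..1} (\<lambda>\<sigma>. \<delta>\<^sub>t j l \<sigma>)"
    and \<delta>\<^sub>x: "\<And>j l \<tau>. j < N\<^sub>1 \<Longrightarrow> l < N\<^sub>2 \<Longrightarrow> \<tau> \<in> {0..1} \<Longrightarrow>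
      \<delta>\<^sub>x j l \<tau> = (\<Sum>k<N\<^sub>1. fourier_diff L\<^sub>1 x j k *\<^sub>R z k l \<tau>)"
    and \<delta>\<^sub>y: "\<And>j l \<tau>. j < N\<^sub>1 \<Longrightarrow> l < N\<^sub>2 \<Longrightarrow> \<tau> \<in> {0..1} \<Longrightarrow>
      \<delta>\<^sub>y j l \<tau> = (\<Sum>m<N\<^sub>2. fourier_diff L\<^sub>2 y l m *\<^sub>R z j m \<tau>)"
    and scheme: "\<And>j l \<tau>. j < N\<^sub>1 \<Longrightarrow> l < N\<^sub>2 \<Longrightarrow> \<tau> \<in> {0..1} \<Longrightarrow>
      M *v \<delta>\<^sub>t j l \<tau> + K *v \<delta>\<^sub>x j l \<tau> + L *v \<delta>\<^sub>y j l \<tau> =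
        gradient (\<lambda>w. S w (x j) (y l)) (z j l \<tau>)"
  shows "\<forall>j<N\<^sub>1. \<forall>l<N\<^sub>2.
    (local_energy S K L (x j) (y l) (z j l 1) (\<delta>\<^sub>x j l 1) (\<delta>\<^sub>y j l 1)
      - local_energy S K L (x j) (y l) (z j l 0) (\<delta>\<^sub>x j l 0) (\<delta>\<^sub>y j l 0)) / \<Delta>t
    + (\<Sum>k<N\<^sub>1. fourier_diff L\<^sub>1 x j k * crk_flux s c K (z j l) (\<delta>\<^sub>t j l) (z k l) (\<delta>\<^sub>t k l))
    + (\<Sum>m<N\<^sub>2. fourier_diff L\<^sub>2 y l m * crk_flux s c L (z j l) (\<delta>\<^sub>t j l) (z j m) (\<delta>\<^sub>t j m))
    = 0"
proof (intro allI impI)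
  fix j l assume j: "j < N\<^sub>1" and l: "l < N\<^sub>2"
  \<comment> \<open>All grid points are covered, since the fluxes couple the point \<open>j\<close>,
    \<open>l\<close> to the others in its row and column.\<close>
  have deriv: "(z j l has_vector_derivative \<Delta>t *\<^sub>R crk_slope s c (\<delta>\<^sub>t j l) \<tau>) (at \<tau> within {0..1})"
    if "j < N\<^sub>1" "l < N\<^sub>2" "\<tau> \<in> {0..1}" for j l \<tau>
    using that crk_stage
    by (intro crk_stage_has_vector_derivative continuous_on_polymonial_function \<delta>\<^sub>t_poly)
  let ?p = "crk_slope s c (\<delta>\<^sub>t j l)"
  let ?IK = "(z j l 1 \<bullet> (K *v \<delta>\<^sub>x j l 1) - z j l 0 \<bullet> (K *v \<delta>\<^sub>x j l 0)) / 2"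
  let ?IL = "(z j l 1 \<bullet> (L *v \<delta>\<^sub>y j l 1) - z j l 0 \<bullet> (L *v \<delta>\<^sub>y j l 0)) / 2"
  let ?F = "\<Sum>k<N\<^sub>1. fourier_diff L\<^sub>1 x j k * crk_flux s c K (z j l) (\<delta>\<^sub>t j l) (z k l) (\<delta>\<^sub>t k l)"
  let ?G = "\<Sum>m<N\<^sub>2. fourier_diff L\<^sub>2 y l m * crk_flux s c L (z j l) (\<delta>\<^sub>t j l) (z j m) (\<delta>\<^sub>t j m)"
  let ?S = "\<lambda>w. S w (x j) (y l)"
  have M_zero: "v \<bullet> (M *v v) = 0" for v
    using skew_symmetric_inner[OF skew(1), of v v] by simp
  \<comment> \<open>The integrand need not vanish pointwise, as \<open>?p\<close> and
    \<open>\<delta>\<^sub>t j l\<close> may differ. Only after integration do both sides of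
    \<open>M\<close> carry the same mean, so that \<open>M_zero\<close> removes each
    summand.\<close>
  have "((\<lambda>\<tau>. ?p \<tau> \<bullet> (M *v \<delta>\<^sub>t j l \<tau>)) has_integral
      (\<Sum>i=1..s. crk_weight s c i *
        (crk_mean s c i (\<delta>\<^sub>t j l) \<bullet> (M *v crk_mean s c i (\<delta>\<^sub>t j l))))) {0..1}"
    by (intro has_integral_crk_slope_inner weights continuous_on_polymonial_function \<delta>\<^sub>t_poly j l)
  then have "((\<lambda>\<tau>. \<Delta>t * (?p \<tau> \<bullet> (M *v \<delta>\<^sub>t j l \<tau>))) has_integral 0) {0..1}"
    by (simp add: M_zero has_integral_mult_right[where y = 0, simplified])
  moreover have "((\<lambda>\<tau>. \<Delta>t * (?p \<tau> \<bullet> (K *v \<delta>\<^sub>x j l \<tau>))) has_integral ?IK - \<Delta>t * ?F) {0..1}"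
    by (rule has_integral_crk_slope_skew_sum[OF weights skew(2)])
      (use j l in \<open>auto intro: deriv \<delta>\<^sub>x\<close>)
  moreover have "((\<lambda>\<tau>. \<Delta>t * (?p \<tau> \<bullet> (L *v \<delta>\<^sub>y j l \<tau>))) has_integral ?IL - \<Delta>t * ?G) {0..1}"
    by (rule has_integral_crk_slope_skew_sum[OF weights skew(3)])
      (use j l in \<open>auto intro: deriv \<delta>\<^sub>y\<close>)
  ultimately have "((\<lambda>\<tau>. \<Delta>t * (?p \<tau> \<bullet> (M *v \<delta>\<^sub>t j l \<tau>)) + \<Delta>t * (?p \<tau> \<bullet> (K *v \<delta>\<^sub>x j l \<tau>))
      + \<Delta>t * (?p \<tau> \<bullet> (L *v \<delta>\<^sub>y j l \<tau>))) has_integral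
      0 + (?IK - \<Delta>t * ?F) + (?IL - \<Delta>t * ?G)) {0..1}"
    by (intro has_integral_add)
  moreover have "((\<lambda>\<tau>. (\<Delta>t *\<^sub>R ?p \<tau>) \<bullet> gradient ?S (z j l \<tau>)) has_integral
      ?S (z j l 1) - ?S (z j l 0)) {0..1}"
    by (intro has_integral_gradient_along S_smooth deriv j l)
  \<comment> \<open>Pairing the scheme with the derivative of \<open>z j l\<close> shows that both
    integrals have the same integrand on \<open>{0..1}\<close>.\<close>
  then have "((\<lambda>\<tau>. \<Delta>t * (?p \<tau> \<bullet> (M *v \<delta>\<^sub>t j l \<tau>)) + \<Delta>t * (?p \<tau> \<bullet> (K *v \<delta>\<^sub>x j l \<tau>))
      + \<Delta>t * (?p \<tau> \<bullet> (L *v \<delta>\<^sub>y j l \<tau>))) has_integral ?S (z j l 1) - ?S (z j l 0)) {0..1}"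
    by (rule has_integral_eq[rotated])
      (simp add: j l inner_add_right distrib_left flip: scheme)
  ultimately have "?S (z j l 1) - ?S (z j l 0) = 0 + (?IK - \<Delta>t * ?F) + (?IL - \<Delta>t * ?G)"
    by (rule has_integral_unique[rotated])
  \<comment> \<open>The halves in \<open>?IK\<close> and \<open>?IL\<close> are those of
    \<open>local_energy\<close>, so the energy increment equals
    \<open>- \<Delta>t * (?F + ?G)\<close>; it remains to divide by the positive time step.\<close>
  then show "(local_energy S K L (x j) (y l) (z j l 1) (\<delta>\<^sub>x j l 1) (\<delta>\<^sub>y j l 1)
      - local_energy S K L (x j) (y l) (z j l 0) (\<delta>\<^sub>x j l 0) (\<delta>\<^sub>y j l 0)) / \<Delta>t + ?F + ?G = 0"
    using steps(3) by (simp add: local_energy_def field_simps)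
qed

end
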